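(* For $\varepsilon$ sufficiently large, the set of feasible solutions of the minimum cost integer flow problem and that of the problem (c-MMCIF) coincide, in the sense that \[\Bigl\{f+\sum_{a\notin T}\lambda_a\,\chi(C_a):\ \lambda\ \text{feasible for (c-MMCIF)}\Bigr\}\] is exactly the set of feasible integer flows.
   Context: Setting: a connected directed graph $D=(V,A)$ with lower capacities $l_{ij}=0$, finite integer upper capacities $u_{ij}$, integer balances $b_i$, and two cost vectors $c^1,c^2$; feasible flows are $f\in\mathbb{Z}^A$ with $\sum_{j:(i,j)\in A}f_{ij}-\sum_{j:(j,i)\in A}f_{ji}=b_i$ for all $i$ and $0\le f_{ij}\le u_{ij}$. A tree solution is a flow $f$ together with a spanning tree $T$ of $D$ (ignoring orientation) and a partition $A\setminus T=L\cup U$ with $f_{ij}=0$ on $L$ and $f_{ij}=u_{ij}$ on $U$. Let $f$ be a tree solution with structure $(T,L,U)$ that is optimal for cost $c^1$. For a non-tree arc $a=(i,j)$, the induced cycle $C_a$ is the unique undirected cycle formed by $a$ and the tree path from $j$ to $i$; it is oriented in the direction of $a$ if $a\in L$ and opposite to $a$ if $a\in U$. $C_a^+$ ($C_a^-$) is the set of arcs of $C_a$ directed along (against) this orientation, and $\chi(C_a)\in\{-1,0,1\}^A$ has $\chi_{ij}(C_a)=1$ if $(i,j)\in C_a^+$, $-1$ if $(i,j)\in C_a^-$, $0$ otherwise; $c^k(C_a)=\sum_{(i,j)\in A}c^k_{ij}\chi_{ij}(C_a)$. Problem (c-MMCIF), with integer variables $\lambda_a$ for $a\in A\setminus T$: minimize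 $\sum_{a\notin T}\lambda_a c^1(C_a)$ subject to $0-f_{ij}\le\sum_{a:(i,j)\in C_a}\lambda_a\chi_{ij}(C_a)\le u_{ij}-f_{ij}$ for all $(i,j)\in\bigcup_{a\notin T}C_a$, and $\sum_{a\notin T}\lambda_a c^2(C_a)\le\varepsilon$. *)

theory Defs
  imports Complex_Main "HOL-Library.FuncSet" "Graph_Theory.Graph_Theory"
begin

(* Undirected walks in a digraph G are walks in biorient G: the step (e, True) traverses the arc e
   from tail to head, the step (e, False) from head to tail.  Unlike in mk_symmetric G, each step
   remembers its arc, so antiparallel arcs (i,j) and (j,i) stay distinct. *)
definition biorient :: "('a, 'b) pre_digraph \<Rightarrow> ('a, 'b \<times> bool) pre_digraph" where
  "biorient G =
     \<lparr> verts = verts G,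
       arcs = arcs G \<times> UNIV,
       tail = (\<lambda>(e, fwd). if fwd then tail G e else head G e),
       head = (\<lambda>(e, fwd). if fwd then head G e else tail G e) \<rparr>"

(* Distinctness of the arcs rules out traversing one arc back and forth. *)
definition undirected_cycle :: "('a, 'b) pre_digraph \<Rightarrow> ('b \<times> bool) list \<Rightarrow> bool" where
  "undirected_cycle G p \<longleftrightarrow> pre_digraph.cycle (biorient G) p \<and> distinct (map fst p)"

(* The library's spanning_tree only excludes directed cycles; here orientation is ignored. *)
definition undirected_spanning_tree :: "('a, 'b) pre_digraph \<Rightarrow> 'b set \<Rightarrow> bool" where
  "undirected_spanning_tree G T \<longleftrightarrow>
     T \<subseteq> arcs G \<and>
     Digraph_Component.connected (G\<lparr>arcs := T\<rparr>) \<and>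
     \<not> (\<exists>p. undirected_cycle (G\<lparr>arcs := T\<rparr>) p)"

definition tree_path :: "('a, 'b) pre_digraph \<Rightarrow> 'b set \<Rightarrow> 'a \<Rightarrow> 'a \<Rightarrow> ('b \<times> bool) list" where
  "tree_path G T v w = (THE p. pre_digraph.apath (biorient (G\<lparr>arcs := T\<rparr>)) v p w)"

definition reverse_walk :: "('b \<times> bool) list \<Rightarrow> ('b \<times> bool) list" where
  "reverse_walk p = rev (map (\<lambda>(e, fwd). (e, \<not> fwd)) p)"

definition induced_cycle ::
    "('a, 'b) pre_digraph \<Rightarrow> 'b set \<Rightarrow> 'b set \<Rightarrow> 'b \<Rightarrow> ('b \<times> bool) list" where
  "induced_cycle G T U a =
     (let C = (a, True) # tree_path G T (head G a) (tail G a)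
      in if a \<in> U then reverse_walk C else C)"

definition cycle_arcs :: "('b \<times> bool) list \<Rightarrow> 'b set" where
  "cycle_arcs C = fst ` set C"

definition forward_arcs :: "('b \<times> bool) list \<Rightarrow> 'b set" where
  "forward_arcs C = {e. (e, True) \<in> set C}"

definition backward_arcs :: "('b \<times> bool) list \<Rightarrow> 'b set" where
  "backward_arcs C = {e. (e, False) \<in> set C}"

definition chi :: "('b \<times> bool) list \<Rightarrow> 'b \<Rightarrow> int" where
  "chi C e = (if e \<in> forward_arcs C then 1 else if e \<in> backward_arcs C then - 1 else 0)"

definition cycle_cost ::
    "('a, 'b) pre_digraph \<Rightarrow> ('b \<Rightarrow> real) \<Rightarrow> ('b \<times> bool) list \<Rightarrow> real" where
  "cycle_cost G c C = (\<Sum>e\<in>arcs G. c e * of_int (chi C e))"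

(* Vectors indexed by a finite set S are functions in extensional S, so that equality of vectors
   is equality of functions. *)
definition feasible_flow ::
    "('a, 'b) pre_digraph \<Rightarrow> ('b \<Rightarrow> int) \<Rightarrow> ('a \<Rightarrow> int) \<Rightarrow> ('b \<Rightarrow> int) \<Rightarrow> bool" where
  "feasible_flow G u b f \<longleftrightarrow>
     f \<in> extensional (arcs G) \<and>
     (\<forall>v\<in>verts G. (\<Sum>e\<in>out_arcs G v. f e) - (\<Sum>e\<in>in_arcs G v. f e) = b v) \<and>
     (\<forall>e\<in>arcs G. 0 \<le> f e \<and> f e \<le> u e)"

definition flow_cost :: "('a, 'b) pre_digraph \<Rightarrow> ('b \<Rightarrow> real) \<Rightarrow> ('b \<Rightarrow> int) \<Rightarrow> real" where
  "flow_cost G c f = (\<Sum>e\<in>arcs G. c e * of_int (f e))"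

definition optimal_flow ::
    "('a, 'b) pre_digraph \<Rightarrow> ('b \<Rightarrow> int) \<Rightarrow> ('a \<Rightarrow> int) \<Rightarrow> ('b \<Rightarrow> real) \<Rightarrow> ('b \<Rightarrow> int) \<Rightarrow> bool" where
  "optimal_flow G u b c f \<longleftrightarrow>
     feasible_flow G u b f \<and>
     (\<forall>g. feasible_flow G u b g \<longrightarrow> flow_cost G c f \<le> flow_cost G c g)"

definition tree_solution ::
    "('a, 'b) pre_digraph \<Rightarrow> ('b \<Rightarrow> int) \<Rightarrow> ('a \<Rightarrow> int) \<Rightarrow> ('b \<Rightarrow> int) \<Rightarrow>
     'b set \<Rightarrow> 'b set \<Rightarrow> 'b set \<Rightarrow> bool" where
  "tree_solution G u b f T L U \<longleftrightarrow>
     feasible_flow G u b f \<and>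
     undirected_spanning_tree G T \<and>
     L \<union> U = arcs G - T \<and> L \<inter> U = {} \<and>
     (\<forall>e\<in>L. f e = 0) \<and> (\<forall>e\<in>U. f e = u e)"

definition mmcif_feasible ::
    "('a, 'b) pre_digraph \<Rightarrow> ('b \<Rightarrow> int) \<Rightarrow> ('b \<Rightarrow> real) \<Rightarrow> ('b \<Rightarrow> int) \<Rightarrow>
     'b set \<Rightarrow> 'b set \<Rightarrow> real \<Rightarrow> ('b \<Rightarrow> int) \<Rightarrow> bool" where
  "mmcif_feasible G u c2 f T U \<epsilon> lam \<longleftrightarrow>
     (let C = induced_cycle G T U in
       lam \<in> extensional (arcs G - T) \<and>
       (\<forall>e \<in> (\<Union>a\<in>arcs G - T. cycle_arcs (C a)).
          0 - f e \<le> (\<Sum>a | a \<in> arcs G - T \<and> e \<in> cycle_arcs (C a). lam a * chi (C a) e) \<and>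
          (\<Sum>a | a \<in> arcs G - T \<and> e \<in> cycle_arcs (C a). lam a * chi (C a) e) \<le> u e - f e) \<and>
       (\<Sum>a\<in>arcs G - T. of_int (lam a) * cycle_cost G c2 (C a)) \<le> \<epsilon>)"

definition add_cycles ::
    "('a, 'b) pre_digraph \<Rightarrow> 'b set \<Rightarrow> 'b set \<Rightarrow> ('b \<Rightarrow> int) \<Rightarrow> ('b \<Rightarrow> int) \<Rightarrow> 'b \<Rightarrow> int" where
  "add_cycles G T U f lam =
     (\<lambda>e\<in>arcs G. f e + (\<Sum>a\<in>arcs G - T. lam a * chi (induced_cycle G T U a) e))"

end

(* A combination of induced cycles is a circulation, so adding it to f preserves the balances, and
   the box constraints say precisely that the capacities are respected.  Conversely, for a feasible
   flow g read lambda_a off as g_a - f_a on L and f_a - g_a on U.  Then g - f minus the combination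
   is a circulation supported on the tree T, hence zero.  As |lambda_a| <= u_a, the epsilon
   constraint holds once epsilon is at least the sum of u_a |c2(C_a)|. *)
theory Submission
  imports Defs
begin

section \<open>Undirected walks and paths in the bioriented digraph\<close>

abbreviation biorient_on :: "('a, 'b) pre_digraph \<Rightarrow> 'b set \<Rightarrow> ('a, 'b \<times> bool) pre_digraph" where
  "biorient_on G S \<equiv> biorient (G\<lparr>arcs := S\<rparr>)"

lemma biorient_simps [simp]:
  "verts (biorient G) = verts G"
  "arcs (biorient G) = arcs G \<times> UNIV"
  "tail (biorient G) (e, d) = (if d then tail G e else head G e)"
  "head (biorient G) (e, d) = (if d then head G e else tail G e)"
  by (simp_all add: biorient_def)

lemma (in wf_digraph) wf_biorient_on:
  assumes "S \<subseteq> arcs G"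
  shows "wf_digraph (biorient_on G S)"
  using assms by unfold_locales (auto split: if_splits)

lemma symmetric_biorient: "symmetric (biorient G)"
proof -
  have "\<exists>y\<in>arcs (biorient G). tail (biorient G) x = head (biorient G) y
      \<and> head (biorient G) x = tail (biorient G) y" if "x \<in> arcs (biorient G)" for x
    using that by (intro bexI[of _ "(fst x, \<not> snd x)"]) (cases x; auto)+
  then show ?thesis by (simp add: symmetric_conv)
qed

lemma (in wf_digraph) biorient_adj:
  assumes "S \<subseteq> arcs G" "e \<in> S"
  shows "tail G e \<rightarrow>\<^bsub>biorient_on G S\<^esub> head G e" "head G e \<rightarrow>\<^bsub>biorient_on G S\<^esub> tail G e"
proof -
  have "(e, True) \<in> arcs (biorient_on G S)" "(e, False) \<in> arcs (biorient_on G S)"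
    using assms by auto
  from this[THEN wf_digraph.in_arcs_imp_in_arcs_ends[OF wf_biorient_on[OF assms(1)]]]
  show "tail G e \<rightarrow>\<^bsub>biorient_on G S\<^esub> head G e" "head G e \<rightarrow>\<^bsub>biorient_on G S\<^esub> tail G e"
    by simp_all
qed

text \<open>Tails and heads do not depend on the arc set, so walks and their vertex lists can be
  moved between sets of arcs.\<close>

lemma compatible_biorient_on: "compatible (biorient_on G S) (biorient_on G S')"
  by (simp add: compatible_def fun_eq_iff)

lemma awalk_biorient_on_subset:
  assumes "pre_digraph.awalk (biorient_on G S) v p w" "fst ` set p \<subseteq> S'"
  shows "pre_digraph.awalk (biorient_on G S') v p w"
  using assms compatible_cas[OF compatible_biorient_on[of S G S']]
  by (force simp: pre_digraph.awalk_def)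

lemma biorient_awalk_verts_arc:
  assumes "wf_digraph (biorient G)" "pre_digraph.awalk (biorient G) v p w" "e \<in> fst ` set p"
  shows "tail G e \<in> set (pre_digraph.awalk_verts (biorient G) v p)"
    and "head G e \<in> set (pre_digraph.awalk_verts (biorient G) v p)"
proof -
  obtain d where d: "(e, d) \<in> set p" using assms(3) by force
  note wf_digraph.awalk_verts_arc1[OF assms(1) d, of v]
    wf_digraph.awalk_verts_arc2[OF assms(1,2) d]
  then show "tail G e \<in> set (pre_digraph.awalk_verts (biorient G) v p)"
    and "head G e \<in> set (pre_digraph.awalk_verts (biorient G) v p)"
    by (auto split: if_splits)
qed

text \<open>A path never returns to its first vertex. That vertex is an end of \<open>e\<close>, and
  traversing \<open>e\<close> again in either direction would visit both ends of
  \<open>e\<close>.\<close>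

lemma biorient_apath_ConsD:
  assumes "wf_digraph (biorient G)" "pre_digraph.apath (biorient G) v ((e, d) # p) w"
  shows "e \<notin> fst ` set p"
proof
  assume e: "e \<in> fst ` set p"
  have "pre_digraph.awalk (biorient G) (head (biorient G) (e, d)) p w"
    "tail (biorient G) (e, d)
      \<notin> set (pre_digraph.awalk_verts (biorient G) (head (biorient G) (e, d)) p)"
    using assms(2)[unfolded wf_digraph.apath_Cons_iff[OF assms(1)]]
    unfolding pre_digraph.apath_def by blast+
  with biorient_awalk_verts_arc[OF assms(1) _ e] show False
    by (auto split: if_splits)
qed

lemma biorient_apath_distinct_arcs:
  assumes "wf_digraph (biorient G)" "pre_digraph.apath (biorient G) v p w"
  shows "distinct (map fst p)"
  using assms(2)
proof (induction p arbitrary: v)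
  case (Cons x p)
  obtain e d where x: "x = (e, d)" by force
  from Cons biorient_apath_ConsD[OF assms(1), of v e d p w] show ?case
    by (auto simp: x wf_digraph.apath_Cons_iff[OF assms(1)])
qed simp

subsection \<open>Forests\<close>

text \<open>Otherwise a path from the head of \<open>t\<close> to its tail that avoids
  \<open>t\<close> would close up with \<open>t\<close> to an undirected cycle. If \<open>t\<close>
  is a loop, this path is empty.\<close>

lemma (in wf_digraph) forest_arc_is_bridge:
  assumes T: "T \<subseteq> arcs G" and acyc: "\<nexists>p. undirected_cycle (G\<lparr>arcs := T\<rparr>) p" and t: "t \<in> T"
  shows "\<not> head G t \<rightarrow>\<^sup>*\<^bsub>biorient_on G (T - {t})\<^esub> tail G t"
proof
  let ?B = "biorient_on G T" and ?B' = "biorient_on G (T - {t})"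
  note wf = wf_biorient_on[OF T]
  have wf': "wf_digraph ?B'" using T by (intro wf_biorient_on) auto
  assume "head G t \<rightarrow>\<^sup>*\<^bsub>?B'\<^esub> tail G t"
  then obtain p where p: "pre_digraph.apath ?B' (head G t) p (tail G t)"
    using wf_digraph.reachable_apath[OF wf'] by blast
  then have walk: "pre_digraph.awalk ?B' (head G t) p (tail G t)"
    and verts: "distinct (pre_digraph.awalk_verts ?B' (head G t) p)"
    by (auto simp: pre_digraph.apath_def)
  have sub: "fst ` set p \<subseteq> T - {t}"
    using walk by (auto simp: pre_digraph.awalk_def)
  have walkT: "pre_digraph.awalk ?B (head G t) p (tail G t)"
    using awalk_biorient_on_subset[OF walk] sub by blast
  have verts': "distinct (pre_digraph.awalk_verts ?B (head G t) p)"
    using verts compatible_awalk_verts[OF compatible_biorient_on[of "T - {t}" G T]] by simp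
  have "pre_digraph.awalk ?B (tail G t) ((t, True) # p) (tail G t)"
    using walkT t by (simp add: wf_digraph.awalk_Cons_iff[OF wf])
  \<comment> \<open>\<open>cycle\<close> asks for distinctness of all visited vertices but the
    first; here these are the vertices of \<open>p\<close>.\<close>
  then have "pre_digraph.cycle ?B ((t, True) # p)"
    using verts' unfolding pre_digraph.cycle_def
    by (auto simp: pre_digraph.awalk_verts.simps)
  moreover have "distinct (map fst ((t, True) # p))"
    using biorient_apath_distinct_arcs[OF wf' p] sub by auto
  ultimately show False using acyc by (auto simp: undirected_cycle_def)
qed

text \<open>Where two paths first diverge, the arc \<open>e\<close> taken by one of them occurs
  neither in its remainder nor in the other path. The remainder followed by the reversal of the
  other path joins the ends of \<open>e\<close> without \<open>e\<close>, although \<open>e\<close>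
  is a bridge.\<close>

lemma (in wf_digraph) forest_apath_unique:
  assumes T: "T \<subseteq> arcs G" and acyc: "\<nexists>p. undirected_cycle (G\<lparr>arcs := T\<rparr>) p"
    and "pre_digraph.apath (biorient_on G T) v p w" "pre_digraph.apath (biorient_on G T) v q w"
  shows "p = q"
proof -
  let ?B = "biorient_on G T"
  note wf = wf_biorient_on[OF T]
  from assms(3,4) show ?thesis
  proof (induction p arbitrary: v q)
    case Nil
    then show ?case
      using wf_digraph.apath_nonempty_ends[OF wf, of v q w]
      by (auto simp: wf_digraph.apath_Nil_iff[OF wf])
  next
    case (Cons x p)
    have "v \<noteq> w" using wf_digraph.apath_nonempty_ends[OF wf Cons.prems(1)] by simp
    then obtain y q' where q: "q = y # q'"
      using Cons.prems(2) by (cases q) (auto simp: wf_digraph.apath_Nil_iff[OF wf])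
    note P = Cons.prems(1)[unfolded wf_digraph.apath_Cons_iff[OF wf]]
      and Q = Cons.prems(2)[unfolded q wf_digraph.apath_Cons_iff[OF wf]]
    show ?case
    proof (cases "x = y")
      case True
      with Cons.IH P Q q show ?thesis by blast
    next
      case False
      obtain e d where x: "x = (e, d)" by force
      obtain e' d' where y: "y = (e', d')" by force
      let ?B' = "biorient_on G (T - {e})"
      have wf': "wf_digraph ?B'" using T by (intro wf_biorient_on) auto
      have e: "e \<in> T" using P x by simp
      have pT: "fst ` set p \<subseteq> T - {e}"
        using P biorient_apath_ConsD[OF wf, of v e d p w] Cons.prems(1)
        by (auto simp: x pre_digraph.apath_def pre_digraph.awalk_def)
      \<comment> \<open>Leaving \<open>v\<close> along one arc in both directions would make that
        arc a loop, and a path contains no loop.\<close>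
      have e': "e' \<noteq> e"
      proof
        assume "e' = e"
        with False x y have "d' = (\<not> d)" by auto
        with \<open>e' = e\<close> x y P Q have "tail ?B x = head ?B x" by auto
        with P wf_digraph.hd_in_awalk_verts(2)[OF wf] show False by fastforce
      qed
      \<comment> \<open>The vertex \<open>v\<close> is an end of \<open>e\<close>, and
        \<open>q'\<close> does not return to \<open>v\<close>.\<close>
      have "e \<notin> fst ` set q'"
      proof
        assume "e \<in> fst ` set q'"
        with Q have "tail G e \<in> set (pre_digraph.awalk_verts ?B (head ?B y) q')"
          "head G e \<in> set (pre_digraph.awalk_verts ?B (head ?B y) q')"
          using biorient_awalk_verts_arc[OF wf, of "head ?B y" q' w e]
          by (auto simp: pre_digraph.apath_def)
        with P Q x show False by (auto split: if_splits)
      qed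
      with e' Q have qT: "fst ` set q \<subseteq> T - {e}"
        by (auto simp: q y pre_digraph.apath_def pre_digraph.awalk_def)
      have "pre_digraph.awalk ?B' (head ?B x) p w" "pre_digraph.awalk ?B' v q w"
        using P Cons.prems(2) pT qT awalk_biorient_on_subset
        by (auto simp: pre_digraph.apath_def)
      then have "head ?B x \<rightarrow>\<^sup>*\<^bsub>?B'\<^esub> w" "v \<rightarrow>\<^sup>*\<^bsub>?B'\<^esub> w"
        using wf_digraph.reachable_awalkI[OF wf'] by blast+
      moreover have sym: "symmetric ?B'"
        by (rule symmetric_biorient)
      ultimately have "head ?B x \<rightarrow>\<^sup>*\<^bsub>?B'\<^esub> v"
        using wf_digraph.reachable_trans[OF wf'] symmetric_reachable by metis
      with P x have "head G e \<rightarrow>\<^sup>*\<^bsub>?B'\<^esub> tail G e \<or> tail G e \<rightarrow>\<^sup>*\<^bsub>?B'\<^esub> head G e"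
        by (auto split: if_splits)
      with symmetric_reachable[OF sym] forest_arc_is_bridge[OF T acyc e] show ?thesis by blast
    qed
  qed
qed

text \<open>\<open>connected\<close> is stated through \<open>mk_symmetric\<close>, which merges
  parallel arcs. Reachability only depends on adjacency, and that is contained in the adjacency of
  \<open>biorient_on G T\<close>.\<close>

lemma (in wf_digraph) spanning_tree_biorient_reachable:
  assumes "undirected_spanning_tree G T" "v \<in> verts G" "w \<in> verts G"
  shows "v \<rightarrow>\<^sup>*\<^bsub>biorient_on G T\<^esub> w"
proof -
  let ?M = "with_proj (mk_symmetric (G\<lparr>arcs := T\<rparr>))"
  have T: "T \<subseteq> arcs G" using assms by (simp add: undirected_spanning_tree_def)
  have "v \<rightarrow>\<^sup>*\<^bsub>?M\<^esub> w"
    using assms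
    by (auto simp: undirected_spanning_tree_def connected_def strongly_connected_def mk_symmetric_def)
  moreover have "arcs_ends ?M \<subseteq> arcs_ends (biorient_on G T)"
    using biorient_adj[OF T] by (auto simp: mk_symmetric_def)
  ultimately have "(v, w) \<in> (arcs_ends (biorient_on G T))\<^sup>*"
    by (meson reachable_rtranclI rtrancl_mono subsetD)
  then show ?thesis
    using wf_digraph.reachable_conv'[OF wf_biorient_on[OF T]] assms(2) by simp
qed

text \<open>Connectivity gives existence and acyclicity gives uniqueness, so the definite
  description in \<open>tree_path\<close> denotes a path.\<close>

lemma (in wf_digraph) tree_path_apath:
  assumes "undirected_spanning_tree G T" "v \<in> verts G" "w \<in> verts G"
  shows "pre_digraph.apath (biorient_on G T) v (tree_path G T v w) w"
proof -
  have T: "T \<subseteq> arcs G" and acyc: "\<nexists>p. undirected_cycle (G\<lparr>arcs := T\<rparr>) p"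
    using assms by (auto simp: undirected_spanning_tree_def)
  have "\<exists>p. pre_digraph.apath (biorient_on G T) v p w"
    using spanning_tree_biorient_reachable[OF assms]
      wf_digraph.reachable_apath[OF wf_biorient_on[OF T]] by blast
  then have "\<exists>!p. pre_digraph.apath (biorient_on G T) v p w"
    using forest_apath_unique[OF T acyc] by blast
  then show ?thesis unfolding tree_path_def by (rule theI')
qed

subsection \<open>Circulations and incidence vectors\<close>

lemma chi_notin: "e \<notin> cycle_arcs C \<Longrightarrow> chi C e = 0"
  by (force simp: chi_def cycle_arcs_def forward_arcs_def backward_arcs_def)

text \<open>\<open>chi\<close> records whether an arc occurs, not how often, so it is additive only
  for a new arc.\<close>

lemma chi_Cons:
  assumes "e \<notin> fst ` set p"
  shows "chi ((e, d) # p) e' = (if e' = e then if d then 1 else - 1 else 0) + chi p e'"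
  using assms by (force simp: chi_def forward_arcs_def backward_arcs_def)

lemma cycle_arcs_reverse_walk: "cycle_arcs (reverse_walk C) = cycle_arcs C"
  by (force simp: cycle_arcs_def reverse_walk_def)

text \<open>Distinctness excludes an arc traversed in both directions, on which \<open>chi\<close>
  would be 1 for the walk and for its reversal.\<close>

lemma chi_reverse_walk:
  assumes "distinct (map fst C)"
  shows "chi (reverse_walk C) e = - chi C e"
proof -
  have "(e, d) \<in> set (reverse_walk C) \<longleftrightarrow> (e, \<not> d) \<in> set C" for d
    by (force simp: reverse_walk_def)
  moreover have "\<not> ((e, True) \<in> set C \<and> (e, False) \<in> set C)"
    using assms by (fastforce simp: distinct_map inj_on_def)
  ultimately show ?thesis
    by (auto simp: chi_def forward_arcs_def backward_arcs_def)
qed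

text \<open>The divergence of \<open>h\<close>, which is the left side of the balance equation in
  \<open>feasible_flow\<close>. Circulations are the vectors of divergence zero.\<close>

definition net_outflow :: "('a, 'b) pre_digraph \<Rightarrow> ('b \<Rightarrow> int) \<Rightarrow> 'a \<Rightarrow> int" where
  "net_outflow G h v = (\<Sum>e\<in>out_arcs G v. h e) - (\<Sum>e\<in>in_arcs G v. h e)"

context fin_digraph
begin

text \<open>As a single sum over all arcs, the divergence is visibly linear in
  \<open>h\<close>.\<close>

lemma net_outflow_conv:
  "net_outflow G h v = (\<Sum>e\<in>arcs G. h e * (of_bool (tail G e = v) - of_bool (head G e = v)))"
proof -
  have "(\<Sum>e\<in>out_arcs G v. h e) = (\<Sum>e\<in>arcs G. h e * of_bool (tail G e = v))"
    by (rule sum.mono_neutral_cong_left) auto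
  moreover have "(\<Sum>e\<in>in_arcs G v. h e) = (\<Sum>e\<in>arcs G. h e * of_bool (head G e = v))"
    by (rule sum.mono_neutral_cong_left) auto
  ultimately show ?thesis
    by (simp add: net_outflow_def right_diff_distrib sum_subtractf)
qed

lemma net_outflow_cong:
  "(\<And>e. e \<in> arcs G \<Longrightarrow> h e = h' e) \<Longrightarrow> net_outflow G h v = net_outflow G h' v"
  by (auto simp: net_outflow_conv intro: sum.cong)

lemma net_outflow_add:
  "net_outflow G (\<lambda>e. h e + h' e) v = net_outflow G h v + net_outflow G h' v"
  by (simp add: net_outflow_conv distrib_right sum.distrib)

lemma net_outflow_minus: "net_outflow G (\<lambda>e. - h e) v = - net_outflow G h v"
  by (simp add: net_outflow_conv sum_negf)

lemma net_outflow_sum: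
  "net_outflow G (\<lambda>e. \<Sum>a\<in>A. x a * h a e) v = (\<Sum>a\<in>A. x a * net_outflow G (h a) v)"
proof -
  have "net_outflow G (\<lambda>e. \<Sum>a\<in>A. x a * h a e) v = (\<Sum>e\<in>arcs G. \<Sum>a\<in>A.
      x a * (h a e * (of_bool (tail G e = v) - of_bool (head G e = v))))"
    by (simp add: net_outflow_conv sum_distrib_right mult.assoc)
  also have "\<dots> = (\<Sum>a\<in>A. x a * net_outflow G (h a) v)"
    by (subst sum.swap) (simp add: net_outflow_conv sum_distrib_left)
  finally show ?thesis .
qed

lemma net_outflow_single:
  assumes "e \<in> arcs G"
  shows "net_outflow G (\<lambda>e'. if e' = e then x else 0) v
    = x * (of_bool (tail G e = v) - of_bool (head G e = v))"
proof -
  have "net_outflow G (\<lambda>e'. if e' = e then x else 0) v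
      = (\<Sum>e'\<in>arcs G. if e' = e then x * (of_bool (tail G e = v) - of_bool (head G e = v)) else 0)"
    unfolding net_outflow_conv by (rule sum.cong) auto
  then show ?thesis using assms by simp
qed

text \<open>The set reachable from the head of \<open>t\<close> without using \<open>t\<close> is a cut that \<open>t\<close> alone crosses.\<close>

lemma forest_circulation_zero:
  assumes T: "T \<subseteq> arcs G" and acyc: "\<nexists>p. undirected_cycle (G\<lparr>arcs := T\<rparr>) p"
    and circ: "\<And>v. v \<in> verts G \<Longrightarrow> net_outflow G h v = 0"
    and supp: "\<And>e. e \<in> arcs G - T \<Longrightarrow> h e = 0"
    and t: "t \<in> arcs G"
  shows "h t = 0"
proof (cases "t \<in> T")
  case True
  define B where "B = biorient_on G (T - {t})"
  have wf: "wf_digraph B" unfolding B_def using T by (intro wf_biorient_on) auto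
  define R where "R = {v. head G t \<rightarrow>\<^sup>*\<^bsub>B\<^esub> v}"
  have vB: "verts B = verts G" by (simp add: B_def)
  have R: "R \<subseteq> verts G"
    using wf_digraph.reachable_in_verts(2)[OF wf] by (auto simp: R_def vB)
  then have finR: "finite R" using finite_verts finite_subset by blast
  have tR: "tail G t \<notin> R"
    using forest_arc_is_bridge[OF T acyc True] by (simp add: R_def B_def)
  have hR: "head G t \<in> R"
    using wf_digraph.reachable_refl[OF wf] t by (simp add: R_def vB)
  have cut: "tail G e \<in> R \<longleftrightarrow> head G e \<in> R" if "e \<in> T" "e \<noteq> t" for e
  proof -
    have "tail G e \<rightarrow>\<^bsub>B\<^esub> head G e" "head G e \<rightarrow>\<^bsub>B\<^esub> tail G e"
      unfolding B_def using that T by (auto intro!: biorient_adj)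
    then show ?thesis
      unfolding R_def using wf_digraph.reachable_adj_trans[OF wf] by blast
  qed
  have "0 = (\<Sum>v\<in>R. net_outflow G h v)"
    using R circ by (simp add: subset_eq)
  also have "\<dots> = (\<Sum>e\<in>arcs G. \<Sum>v\<in>R. h e * (of_bool (tail G e = v) - of_bool (head G e = v)))"
    unfolding net_outflow_conv by (rule sum.swap)
  also have "\<dots> = (\<Sum>e\<in>arcs G. h e * (of_bool (tail G e \<in> R) - of_bool (head G e \<in> R)))"
  proof -
    have "(\<Sum>v\<in>R. of_bool (x = v)) = (of_bool (x \<in> R) :: int)" for x
      using finR by (simp add: of_bool_def)
    then show ?thesis
      by (simp add: sum_distrib_left[symmetric] sum_subtractf)
  qed
  \<comment> \<open>Arcs outside \<open>T\<close> carry zero and the other tree arcs do not cross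
    the cut. The arc \<open>t\<close> enters \<open>R\<close>, whence the minus sign.\<close>
  also have "\<dots> = (\<Sum>e\<in>arcs G. if e = t then - h t else 0)"
    using cut supp tR hR by (intro sum.cong) auto
  also have "\<dots> = - h t" using t by simp
  finally show ?thesis by simp
qed (use supp t in blast)

text \<open>Each step moves one unit from its start to its end, whichever way it traverses the arc,
  so the contributions telescope along the walk.\<close>

lemma net_outflow_chi:
  assumes "S \<subseteq> arcs G" "pre_digraph.awalk (biorient_on G S) v p w" "distinct (map fst p)"
  shows "net_outflow G (chi p) x = of_bool (v = x) - of_bool (w = x)"
  using assms(2,3)
proof (induction p arbitrary: v)
  case Nil
  then show ?case
    by (simp add: wf_digraph.awalk_Nil_iff[OF wf_biorient_on[OF assms(1)]] net_outflow_conv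
        chi_def forward_arcs_def backward_arcs_def)
next
  case (Cons y p)
  obtain e d where y: "y = (e, d)" by force
  have e: "e \<in> arcs G" "v = (if d then tail G e else head G e)"
    and walk: "pre_digraph.awalk (biorient_on G S) (if d then head G e else tail G e) p w"
    using Cons.prems(1) assms(1)
    by (auto simp: y wf_digraph.awalk_Cons_iff[OF wf_biorient_on[OF assms(1)]] split: if_splits)
  have "chi (y # p) = (\<lambda>e'. (if e' = e then if d then 1 else - 1 else 0) + chi p e')"
    using Cons.prems(2) chi_Cons[of e p d] by (auto simp: y)
  then show ?case
    using Cons.IH[OF walk] Cons.prems(2) e
    by (simp add: net_outflow_add net_outflow_single)
qed

text \<open>The tree path sends one unit from the head of \<open>a\<close> back to its tail, which
  cancels the divergence of \<open>a\<close> itself. As that path stays in \<open>T\<close>, the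
  only non-tree arc of the cycle is \<open>a\<close>.\<close>

lemma
  assumes tree: "undirected_spanning_tree G T" and a: "a \<in> arcs G - T"
  shows net_outflow_chi_induced_cycle: "net_outflow G (chi (induced_cycle G T U a)) v = 0"
    and chi_induced_cycle_nontree: "e \<notin> T \<Longrightarrow>
      chi (induced_cycle G T U a) e = (if e = a then if a \<in> U then - 1 else 1 else 0)"
proof -
  define p where "p = tree_path G T (head G a) (tail G a)"
  have T: "T \<subseteq> arcs G" using tree by (simp add: undirected_spanning_tree_def)
  note wf = wf_biorient_on[OF T]
  have p: "pre_digraph.apath (biorient_on G T) (head G a) p (tail G a)"
    unfolding p_def using tree a by (intro tree_path_apath) auto
  then have walk: "pre_digraph.awalk (biorient_on G T) (head G a) p (tail G a)"
    by (simp add: pre_digraph.apath_def)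
  have pT: "fst ` set p \<subseteq> T" using walk by (auto simp: pre_digraph.awalk_def)
  have dist: "distinct (map fst p)" using biorient_apath_distinct_arcs[OF wf p] .
  have ap: "a \<notin> fst ` set p" using pT a by blast
  then have distC: "distinct (map fst ((a, True) # p))" using dist by simp
  \<comment> \<open>The sign accounts for the reversal of the cycle when \<open>a\<close> is in
    \<open>U\<close>.\<close>
  define s :: int where "s = (if a \<in> U then - 1 else 1)"
  have chi: "chi (induced_cycle G T U a) e = s * ((if e = a then 1 else 0) + chi p e)" for e
    using chi_reverse_walk[OF distC, of e] chi_Cons[OF ap, of True e]
    by (simp add: induced_cycle_def p_def[symmetric] s_def)
  have "net_outflow G (chi (induced_cycle G T U a)) v
      = s * net_outflow G (\<lambda>e. (if e = a then 1 else 0) + chi p e) v"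
    by (simp add: net_outflow_conv chi sum_distrib_left mult.assoc)
  also have "\<dots> = 0"
    using a net_outflow_chi[OF T walk dist] by (simp add: net_outflow_add net_outflow_single)
  finally show "net_outflow G (chi (induced_cycle G T U a)) v = 0" .
  assume "e \<notin> T"
  then have "chi p e = 0" using pT by (intro chi_notin) (auto simp: cycle_arcs_def)
  then show "chi (induced_cycle G T U a) e = (if e = a then if a \<in> U then - 1 else 1 else 0)"
    by (simp add: chi s_def)
qed

subsection \<open>Flows as combinations of induced cycles\<close>

text \<open>Cycles that miss \<open>e\<close> contribute zero, so the sums in (c-MMCIF) agree with
  those in \<open>add_cycles\<close>.\<close>

lemma sum_chi_restrict:
  "(\<Sum>a | a \<in> arcs G - T \<and> e \<in> cycle_arcs (C a). lam a * chi (C a) e)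
    = (\<Sum>a\<in>arcs G - T. lam a * chi (C a) e)"
  by (rule sum.mono_neutral_left) (use chi_notin in force)+

lemma feasible_add_cycles:
  assumes tree: "undirected_spanning_tree G T" and f: "feasible_flow G u b f"
    and lam: "mmcif_feasible G u c f T U \<epsilon> lam"
  shows "feasible_flow G u b (add_cycles G T U f lam)"
proof -
  let ?C = "induced_cycle G T U" and ?g = "add_cycles G T U f lam"
  have "net_outflow G ?g v = net_outflow G f v" for v
  proof -
    have "net_outflow G ?g v
        = net_outflow G (\<lambda>e. f e + (\<Sum>a\<in>arcs G - T. lam a * chi (?C a) e)) v"
      by (rule net_outflow_cong) (simp add: add_cycles_def)
    then show ?thesis
      using net_outflow_chi_induced_cycle[OF tree]
      by (simp add: net_outflow_add net_outflow_sum)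
  qed
  \<comment> \<open>(c-MMCIF) bounds only the arcs on some induced cycle. On every other arc the
    combination vanishes and the value of \<open>f\<close> is kept.\<close>
  moreover have "0 \<le> ?g e \<and> ?g e \<le> u e" if e: "e \<in> arcs G" for e
  proof (cases "e \<in> (\<Union>a\<in>arcs G - T. cycle_arcs (?C a))")
    case True
    with lam have "0 - f e \<le> (\<Sum>a\<in>arcs G - T. lam a * chi (?C a) e)"
      "(\<Sum>a\<in>arcs G - T. lam a * chi (?C a) e) \<le> u e - f e"
      unfolding mmcif_feasible_def Let_def sum_chi_restrict by blast+
    with e show ?thesis by (simp add: add_cycles_def)
  next
    case False
    then have "(\<Sum>a\<in>arcs G - T. lam a * chi (?C a) e) = 0"
      by (intro sum.neutral) (auto simp: chi_notin)
    with e f show ?thesis by (simp add: add_cycles_def feasible_flow_def)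
  qed
  ultimately show ?thesis
    using f by (simp add: feasible_flow_def net_outflow_def add_cycles_def)
qed

text \<open>The induced cycles are the fundamental cycles of the spanning tree, so the values of
  \<open>g - f\<close> outside \<open>T\<close> force the coefficients.\<close>

lemma feasible_flow_is_add_cycles:
  assumes sol: "tree_solution G u b f T L U" and g: "feasible_flow G u b g"
    and \<epsilon>: "(\<Sum>a\<in>arcs G - T. of_int (u a) * \<bar>cycle_cost G c (induced_cycle G T U a)\<bar>) \<le> \<epsilon>"
  obtains lam where "mmcif_feasible G u c f T U \<epsilon> lam" "g = add_cycles G T U f lam"
proof -
  let ?C = "induced_cycle G T U"
  have f: "feasible_flow G u b f" and tree: "undirected_spanning_tree G T"
    and LU: "L \<union> U = arcs G - T" "\<forall>e\<in>L. f e = 0" "\<forall>e\<in>U. f e = u e"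
    using sol by (auto simp: tree_solution_def)
  have T: "T \<subseteq> arcs G" and acyc: "\<nexists>p. undirected_cycle (G\<lparr>arcs := T\<rparr>) p"
    using tree by (auto simp: undirected_spanning_tree_def)
  \<comment> \<open>In both cases this is the distance of \<open>g a\<close> from the bound at which
    \<open>f a\<close> lies. The sign on \<open>U\<close> offsets the value -1 of \<open>chi\<close>
    there.\<close>
  define lam where "lam = (\<lambda>a\<in>arcs G - T. if a \<in> U then f a - g a else g a - f a)"
  define s where "s = (\<lambda>e. \<Sum>a\<in>arcs G - T. lam a * chi (?C a) e)"
  have s_out: "net_outflow G s v = 0" for v
    unfolding s_def using net_outflow_chi_induced_cycle[OF tree] by (simp add: net_outflow_sum)
  have s_nontree: "s e = g e - f e" if e: "e \<in> arcs G - T" for e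
  proof -
    have "s e = (\<Sum>a\<in>arcs G - T. if a = e then g e - f e else 0)"
      unfolding s_def using e
      by (intro sum.cong) (auto simp: chi_induced_cycle_nontree[OF tree] lam_def)
    then show ?thesis using e by simp
  qed
  have s: "s e = g e - f e" if e: "e \<in> arcs G" for e
  proof -
    \<comment> \<open>Both flows have the same balances, so \<open>h\<close> is a circulation, and
      it vanishes outside \<open>T\<close>. The form with unary minus fits
      \<open>net_outflow_add\<close> and \<open>net_outflow_minus\<close>.\<close>
    define h where "h = (\<lambda>e. (g e + - f e) + - s e)"
    have "net_outflow G h v = 0" if "v \<in> verts G" for v
      using f g that s_out unfolding h_def
      by (simp only: net_outflow_add net_outflow_minus) (simp add: feasible_flow_def net_outflow_def)
    moreover have "h e = 0" if "e \<in> arcs G - T" for e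
      using s_nontree[OF that] by (simp add: h_def)
    ultimately have "h e = 0" using forest_circulation_zero[OF T acyc _ _ e] by blast
    then show ?thesis by (simp add: h_def)
  qed
  show ?thesis
  proof
    show "g = add_cycles G T U f lam"
      using g s by (auto simp: add_cycles_def s_def feasible_flow_def fun_eq_iff extensional_def)
    \<comment> \<open>The bounds on \<open>s\<close> hold on arcs of \<open>G\<close>, while
      (c-MMCIF) ranges over arcs of induced cycles.\<close>
    have cycle_arcs: "cycle_arcs (?C a) \<subseteq> arcs G" if a: "a \<in> arcs G - T" for a
    proof -
      have "pre_digraph.apath (biorient_on G T)
          (head G a) (tree_path G T (head G a) (tail G a)) (tail G a)"
        using tree a by (intro tree_path_apath) auto
      then have "set (tree_path G T (head G a) (tail G a)) \<subseteq> T \<times> UNIV"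
        by (simp add: pre_digraph.apath_def pre_digraph.awalk_def)
      then show ?thesis
        using a T by (auto simp: induced_cycle_def Let_def cycle_arcs_reverse_walk)
          (auto simp: cycle_arcs_def)
    qed
    have "(\<Sum>a\<in>arcs G - T. of_int (lam a) * cycle_cost G c (?C a))
        \<le> (\<Sum>a\<in>arcs G - T. of_int (u a) * \<bar>cycle_cost G c (?C a)\<bar>)"
    proof (rule sum_mono)
      fix a assume a: "a \<in> arcs G - T"
      then have "0 \<le> g a" "g a \<le> u a" using g by (auto simp: feasible_flow_def)
      moreover have "a \<in> U \<and> f a = u a \<or> a \<notin> U \<and> f a = 0" using a LU by blast
      ultimately have lam: "\<bar>lam a\<bar> \<le> u a" using a by (auto simp: lam_def)
      have "of_int (lam a) * cycle_cost G c (?C a) \<le> \<bar>of_int (lam a)\<bar> * \<bar>cycle_cost G c (?C a)\<bar>"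
        using abs_ge_self by (simp add: abs_mult[symmetric])
      also have "\<dots> \<le> of_int (u a) * \<bar>cycle_cost G c (?C a)\<bar>"
        using lam by (intro mult_right_mono) (simp_all flip: of_int_abs)
      finally show "of_int (lam a) * cycle_cost G c (?C a)
        \<le> of_int (u a) * \<bar>cycle_cost G c (?C a)\<bar>" .
    qed
    moreover have "0 - f e \<le> s e \<and> s e \<le> u e - f e" if "e \<in> arcs G" for e
      using s[OF that] g that by (simp add: feasible_flow_def)
    moreover have "lam \<in> extensional (arcs G - T)" by (simp add: lam_def)
    ultimately show "mmcif_feasible G u c f T U \<epsilon> lam"
      using \<epsilon> cycle_arcs
      unfolding mmcif_feasible_def Let_def sum_chi_restrict s_def by fastforce
  qed
qed

end

theorem theorem4p11:
  fixes D :: "'v pair_pre_digraph"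
    and u :: "'v \<times> 'v \<Rightarrow> int" and b :: "'v \<Rightarrow> int"
    and c1 c2 :: "'v \<times> 'v \<Rightarrow> real"
    and f :: "'v \<times> 'v \<Rightarrow> int" and T L U :: "('v \<times> 'v) set"
  assumes "pair_fin_digraph D"
    and "Digraph_Component.connected (with_proj D)"
    and "tree_solution (with_proj D) u b f T L U"
    and "optimal_flow (with_proj D) u b c1 f"
  shows "\<exists>\<epsilon>\<^sub>0::real. \<forall>\<epsilon>\<ge>\<epsilon>\<^sub>0.
    {add_cycles (with_proj D) T U f lam | lam. mmcif_feasible (with_proj D) u c2 f T U \<epsilon> lam}
      = {g. feasible_flow (with_proj D) u b g}"
proof (intro exI allI impI)
  let ?G = "with_proj D"
  interpret pair_fin_digraph D by fact
  have fin: "fin_digraph ?G" by (rule fin_digraph)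
  have tree: "undirected_spanning_tree ?G T" and f: "feasible_flow ?G u b f"
    using assms(3) by (auto simp: tree_solution_def)
  fix \<epsilon> :: real
  \<comment> \<open>This assumption instantiates the threshold left open by \<open>exI\<close>; the
    sum depends neither on a flow \<open>g\<close> nor on the multipliers.\<close>
  assume \<epsilon>: "(\<Sum>a\<in>arcs ?G - T. of_int (u a) * \<bar>cycle_cost ?G c2 (induced_cycle ?G T U a)\<bar>) \<le> \<epsilon>"
  show "{add_cycles ?G T U f lam | lam. mmcif_feasible ?G u c2 f T U \<epsilon> lam}
      = {g. feasible_flow ?G u b g}"
    using fin_digraph.feasible_add_cycles[OF fin tree f]
      fin_digraph.feasible_flow_is_add_cycles[OF fin assms(3) _ \<epsilon>]
    by blast
qed

end
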